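(* Let $n\ge2$ and $v,d\in\mathbb N^{n-1}$ be such that $\mathfrak M^{reg}_{\mathbf 0}(v,d)\neq\emptyset$. Let $\phi:\mathfrak M^0_{\mathbf 0}(v,d)\to T_\lambda\cap\overline{\mathcal O_\mu}$ and $\psi:T_\lambda\cap\overline{\mathcal O_\mu}\to L^{<0}GL_m\cdot\mathsf L_\lambda\cap\overline{L^{\ge0}GL_m\cdot\mathsf L_\mu}$ be the isomorphisms given by the explicit formulas in the context. Then the isomorphism $\psi\circ\phi$ is given by $$(x_i,\bar x_i,p_i,q_i)\ \longmapsto\ \Big(1+z^{-1}\sum_{r,l=0}^{\infty}z^{-l}\,q\,\bar x^{\,r}x^{l}\,p\Big)\mathsf L_\lambda ,$$ where $(x,\bar x,p,q)=(\oplus x_i,\oplus\bar x_i,\oplus p_i,\oplus q_i)$.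
   Context: $\mathbb N=\{0,1,\dots\}$. $V_i,D_i$ ($1\le i\le n-1$) are complex vector spaces of dimensions $v_i,d_i$; $V=\bigoplus V_i$, $D=\bigoplus D_i$, $m=\dim D$. $M^0(v,d)$ is the variety of quadruples $(x,\bar x,p,q)$, $x_i:V_i\to V_{i+1}$, $\bar x_i:V_{i+1}\to V_i$ ($1\le i\le n-2$), $p_i:D_i\to V_i$, $q_i:V_i\to D_i$, with $\bar x_ix_i=x_{i-1}\bar x_{i-1}+p_iq_i$ for $1\le i\le n-1$ (terms with index $0$ or $n-1$ in $x,\bar x$ are zero). The sums $\oplus x_i,\oplus\bar x_i$ are endomorphisms of $V$, and $p:D\to V$, $q:V\to D$. $G(V)=\prod GL(V_i)$ acts by $(g_{i+1}x_ig_i^{-1},g_i\bar x_ig_{i+1}^{-1},g_ip_i,q_ig_i^{-1})$. $\mathfrak M^0_{\mathbf 0}(v,d)=\operatorname{Spec}\mathcal O(M^0(v,d))^{G(V)}$. A quadruple is stable if no proper graded subspace of $V$ containing $\operatorname{Im}p$ is preserved by $x,\bar x$; costable if no nonzero graded subspace contained in $\ker q$ is preserved by $x,\bar x$. $\mathfrak M^{reg}_{\mathbf 0}(v,d)$ is the quotient of the stable and costable locus by $G(V)$, an open subvariety of $\mathfrak M^0_{\mathbf 0}(v,d)$. $\lambda=(\lambda_1\ge\dots\ge\lambda_m)$ is the partition with $d_i$ parts equal to $i$; $\mu\in\mathbb Z^m$ is the nonincreasing sequence in which $i$ occurs $v_{i+1}+v_{i-1}+d_i-2v_i$ times, $0\le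 i\le n$ (with $v_j=0$ for $j\notin\{1,\dots,n-1\}$ and $d_0=d_n=0$). Fix a basis $\mathbf e_1,\dots,\mathbf e_m$ of $D$ adapted to $D=\bigoplus D_i$ such that $\mathbf e_j\in D_{\lambda_j}$. Lattices: $\mathsf L_\eta=\bigoplus_jz^{-\eta_j}\mathbb C[[z]]\mathbf e_j\subset D((z))$; $\mathsf L_\lambda=\bigoplus_iz^{-i}D_i[[z]]$, $\mathsf L_0=D[[z]]$, $\mathsf U_\lambda=\bigoplus_iz^{-i}D_i$. $L^{\ge0}GL_m=GL_m(\mathbb C[[z]])$, $L^{<0}GL_m=\ker(GL_m(\mathbb C[z^{-1}])\to GL_m)$ (evaluation at $z=\infty$), acting on lattices in $D((z))$, i.e. on the affine Grassmannian; closure is taken there. Let $\widetilde D_1=\bigoplus_{1\le k\le j\le n-1}D_j^{(k)}$, with $D_j^{(k)}$ a copy of $D_j$, identified with $\mathsf L_\lambda/\mathsf L_0$ by sending $e\in D_j^{(k)}$ to the class of $z^{-k}e$. Let $\mathsf x$ be the nilpotent operator on $\widetilde D_1$ sending $D_j^{(k)}$ identically to $D_j^{(k-1)}$ for $k\ge2$ and $D_j^{(1)}$ to $0$ (i.e. multiplication by $z$). $\mathcal O_\mu\subset\operatorname{End}(\widetilde D_1)$ is the nilpotent orbit of type $\mu$. $T_\lambda=\mathsf x+C$, with $C$ the space of operators all of whose blocks $D^{(h')}_{j'}\to D^{(h)}_j$ vanish unless $h=j$ and $h'\le j$. The map $\phi$: $\phi(x_i,\bar x_i,p_i,q_i)=\mathsf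 x+f_1$, where the block of $f_1$ from $D^{(h')}_{j'}$ to $D^{(h)}_j$ is $q_jx_{j-1}\cdots x_{h'}\bar x_{h'}\cdots\bar x_{j'-1}p_{j'}$ if $h=j$ and $h'\le j$, and $0$ otherwise. The map $\psi$: regard $f_1$ as a linear map $\mathsf L_\lambda\to\mathsf L_\lambda/\mathsf L_0=\widetilde D_1\to\mathsf U_\lambda$ (with $D_j^{(j)}$ identified with $z^{-j}D_j$). Then $\psi(\mathsf x+f_1)=\big(1+\sum_{k\ge1}z^{-k}f_1(z+f_1)^{k-1}\big)\mathsf L_\lambda$. *)

theory Defs
  imports
    Complex_Main
    "HOL-Library.FuncSet"
    "HOL-Library.Function_Algebras"
    "HOL-Library.Groups_Big_Fun"
begin

section \<open>Varieties as spaces with functions\<close>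

text \<open>
  All varieties below are described on closed points, with the Zariski topology and their regular
  functions. A variety is a pair of a set of coordinate functions on an ambient affine space and a
  set of charts \<open>(Y, \<pi>)\<close>; each \<open>Y\<close> is a locally closed part of the ambient space and \<open>\<pi>\<close> maps it
  to the set of points. Closedness and regularity are tested after pulling back along every \<open>\<pi>\<close>.
  For an affine variety there is a single chart with \<open>\<pi> = id\<close>; a Grassmannian is presented by its
  frames (a Zariski locally trivial bundle over it, so that this gives the usual structure).
\<close>

inductive_set polyfun :: "('s \<Rightarrow> complex) set \<Rightarrow> ('s \<Rightarrow> complex) set"
  for C :: "('s \<Rightarrow> complex) set" where
  coord: "f \<in> C \<Longrightarrow> f \<in> polyfun C"
| const: "(\<lambda>_. c) \<in> polyfun C"
| add: "f \<in> polyfun C \<Longrightarrow> g \<in> polyfun C \<Longrightarrow> (\<lambda>s. f s + g s) \<in> polyfun C"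
| mult: "f \<in> polyfun C \<Longrightarrow> g \<in> polyfun C \<Longrightarrow> (\<lambda>s. f s * g s) \<in> polyfun C"

type_synonym ('s, 'x) variety = "('s \<Rightarrow> complex) set \<times> ('s set \<times> ('s \<Rightarrow> 'x)) set"

definition points :: "('s, 'x) variety \<Rightarrow> 'x set" where
  "points X = (\<Union>(Y, \<pi>) \<in> snd X. \<pi> ` Y)"

definition zariski_closed :: "('s, 'x) variety \<Rightarrow> 'x set \<Rightarrow> bool" where
  "zariski_closed X Z \<longleftrightarrow> Z \<subseteq> points X \<and>
     (\<forall>(Y, \<pi>) \<in> snd X. \<exists>P \<subseteq> polyfun (fst X). {y \<in> Y. \<pi> y \<in> Z} = {y \<in> Y. \<forall>f\<in>P. f y = 0})"

definition zariski_closure :: "('s, 'x) variety \<Rightarrow> 'x set \<Rightarrow> 'x set" where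
  "zariski_closure X S = \<Inter> {Z. zariski_closed X Z \<and> S \<subseteq> Z}"

definition zariski_open :: "('s, 'x) variety \<Rightarrow> 'x set \<Rightarrow> bool" where
  "zariski_open X U \<longleftrightarrow> U \<subseteq> points X \<and> zariski_closed X (points X - U)"

definition regular_on :: "('s, 'x) variety \<Rightarrow> 'x set \<Rightarrow> ('x \<Rightarrow> complex) \<Rightarrow> bool" where
  "regular_on X U f \<longleftrightarrow>
     (\<forall>(Y, \<pi>) \<in> snd X. \<forall>y\<in>Y. \<pi> y \<in> U \<longrightarrow>
       (\<exists>a\<in>polyfun (fst X). \<exists>b\<in>polyfun (fst X). b y \<noteq> 0 \<and>
         (\<forall>y'\<in>Y. \<pi> y' \<in> U \<and> b y' \<noteq> 0 \<longrightarrow> f (\<pi> y') = a y' / b y')))"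

definition subvariety :: "('s, 'x) variety \<Rightarrow> 'x set \<Rightarrow> ('s, 'x) variety" where
  "subvariety X S = (fst X, (\<lambda>(Y, \<pi>). ({y \<in> Y. \<pi> y \<in> S}, \<pi>)) ` snd X)"

definition affine_variety :: "('s \<Rightarrow> complex) set \<Rightarrow> 's set \<Rightarrow> ('s, 's) variety" where
  "affine_variety C Y = (C, {(Y, \<lambda>y. y)})"

definition variety_iso ::
    "('s, 'x) variety \<Rightarrow> ('t, 'y) variety \<Rightarrow> ('x \<Rightarrow> 'y) \<Rightarrow> bool" where
  "variety_iso X X' F \<longleftrightarrow>
     bij_betw F (points X) (points X') \<and>
     (\<forall>U \<subseteq> points X. zariski_open X U \<longleftrightarrow> zariski_open X' (F ` U)) \<and>
     (\<forall>U g. zariski_open X U \<longrightarrow> (regular_on X' (F ` U) g \<longleftrightarrow> regular_on X U (g \<circ> F)))"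


section \<open>Gradings and formal Laurent series\<close>

definition decomposes :: "nat \<Rightarrow> (nat \<Rightarrow> 'a::ab_group_add set) \<Rightarrow> 'a \<Rightarrow> (nat \<Rightarrow> 'a) \<Rightarrow> bool" where
  "decomposes n U u c \<longleftrightarrow>
     (\<forall>i. c i \<in> U i) \<and> (\<forall>i. i \<notin> {1..<n} \<longrightarrow> c i = 0) \<and> u = (\<Sum>i = 1..<n. c i)"

definition component :: "nat \<Rightarrow> (nat \<Rightarrow> 'a::ab_group_add set) \<Rightarrow> nat \<Rightarrow> 'a \<Rightarrow> 'a" where
  "component n U i u = (THE c. decomposes n U u c) i"

text \<open>A series \<open>\<Sum>t. w\<^sub>t z\<^sup>t\<close> is the function \<open>t \<mapsto> w\<^sub>t\<close>.\<close>

type_synonym 'd series = "int \<Rightarrow> 'd"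

definition zpow :: "int \<Rightarrow> 'd series \<Rightarrow> 'd series" where
  "zpow k w = (\<lambda>t. w (t - k))"

definition monomial :: "int \<Rightarrow> 'd::zero \<Rightarrow> 'd series" where
  "monomial k a = (\<lambda>t. if t = k then a else 0)"

definition polar_part :: "'d::zero series \<Rightarrow> 'd series" where
  "polar_part w = (\<lambda>t. if t < 0 then w t else 0)"

definition zpow_L0 :: "int \<Rightarrow> 'd::zero series set" where
  "zpow_L0 N = {w. \<forall>t < N. w t = 0}"

text \<open>Series \<open>\<Sum>k. g\<^sub>k z\<^sup>k\<close> of operators, their action on \<open>D((z))\<close> and their product.\<close>

definition series_act :: "(int \<Rightarrow> 'd \<Rightarrow> 'd::comm_monoid_add) \<Rightarrow> 'd series \<Rightarrow> 'd series" where
  "series_act g w = (\<lambda>t. Sum_any (\<lambda>k. g k (w (t - k))))"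

definition series_mult ::
    "(int \<Rightarrow> 'd \<Rightarrow> 'd) \<Rightarrow> (int \<Rightarrow> 'd \<Rightarrow> 'd) \<Rightarrow> int \<Rightarrow> 'd \<Rightarrow> 'd::comm_monoid_add" where
  "series_mult g h = (\<lambda>k a. Sum_any (\<lambda>i. g i (h (k - i) a)))"

definition series_one :: "int \<Rightarrow> 'd \<Rightarrow> 'd::zero" where
  "series_one = (\<lambda>k a. if k = 0 then a else 0)"


section \<open>Quiver data of type A\<close>

text \<open>The list \<open>\<lambda>\<^sub>1 \<ge> \<dots> \<ge> \<lambda>\<^sub>m\<close>, indexed from 0.\<close>

definition lambda_part :: "nat \<Rightarrow> (nat \<Rightarrow> nat) \<Rightarrow> nat list" where
  "lambda_part n d = concat (map (\<lambda>i. replicate (d i) i) (rev [1..<n]))"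

text \<open>
  The multiplicities below are nonnegative as soon as a stable and costable quadruple exists, so
  \<open>nat\<close> does not truncate there. In \<open>mu_mult\<close> the term \<open>v (i - 1)\<close> for \<open>i = 0\<close> is \<open>v 0 = 0\<close>.
\<close>

definition mu_mult :: "(nat \<Rightarrow> nat) \<Rightarrow> (nat \<Rightarrow> nat) \<Rightarrow> nat \<Rightarrow> int" where
  "mu_mult v d i = int (v (i + 1)) + int (v (i - 1)) + int (d i) - 2 * int (v i)"

definition mu_part :: "nat \<Rightarrow> (nat \<Rightarrow> nat) \<Rightarrow> (nat \<Rightarrow> nat) \<Rightarrow> nat list" where
  "mu_part n v d = concat (map (\<lambda>i. replicate (nat (mu_mult v d i)) i) (rev [0..<n + 1]))"

text \<open>Quadruples \<open>(x, \<bar>x, p, q)\<close>, each given by the total map \<open>\<oplus>x\<^sub>i\<close> etc.\<close>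

type_synonym ('v, 'd) quad = "('v \<Rightarrow> 'v) \<times> ('v \<Rightarrow> 'v) \<times> ('d \<Rightarrow> 'v) \<times> ('v \<Rightarrow> 'd)"

text \<open>
  The types \<open>'v\<close> and \<open>'d\<close> are the total spaces \<open>V = \<Oplus>V\<^sub>i\<close> and \<open>D = \<Oplus>D\<^sub>i\<close>. The dimension conditions
  are spelled out by finite bases because \<open>dim\<close> is 0 for infinite-dimensional spaces. Outside
  \<open>1 \<le> i \<le> n - 1\<close> they say \<open>V\<^sub>i = D\<^sub>i = 0\<close>.
\<close>

locale quiver =
  vs: vector_space scV + ds: vector_space scD
  for scV :: "complex \<Rightarrow> 'v::ab_group_add \<Rightarrow> 'v"
    and scD :: "complex \<Rightarrow> 'd::ab_group_add \<Rightarrow> 'd" +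
  fixes n :: nat
    and v d :: "nat \<Rightarrow> nat"
    and V :: "nat \<Rightarrow> 'v set"
    and D :: "nat \<Rightarrow> 'd set"
    and e :: "nat \<Rightarrow> 'd"
  assumes v_outside: "i \<notin> {1..<n} \<Longrightarrow> v i = 0"
    and d_outside: "i \<notin> {1..<n} \<Longrightarrow> d i = 0"
    and V_dim: "\<exists>B. finite B \<and> card B = v i \<and> vs.independent B \<and> vs.span B = V i"
    and D_dim: "\<exists>B. finite B \<and> card B = d i \<and> ds.independent B \<and> ds.span B = D i"
    and V_direct: "\<exists>!c. decomposes n V u c"
    and D_direct: "\<exists>!c. decomposes n D a c"
    and e_inj: "inj_on e {..<length (lambda_part n d)}"
    and e_independent: "ds.independent (e ` {..<length (lambda_part n d)})"
    and e_span: "ds.span (e ` {..<length (lambda_part n d)}) = UNIV"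
    and e_adapted: "j < length (lambda_part n d) \<Longrightarrow> e j \<in> D (lambda_part n d ! j)"
begin

subsection \<open>Quadruples and quotients\<close>

definition M0 :: "('v, 'd) quad set" where
  "M0 = {(x, xb, p, q).
     Vector_Spaces.linear scV scV x \<and> Vector_Spaces.linear scV scV xb \<and>
     Vector_Spaces.linear scD scV p \<and> Vector_Spaces.linear scV scD q \<and>
     (\<forall>i. x ` V i \<subseteq> V (i + 1)) \<and> (\<forall>i. xb ` V (i + 1) \<subseteq> V i) \<and>
     (\<forall>i. p ` D i \<subseteq> V i) \<and> (\<forall>i. q ` V i \<subseteq> D i) \<and>
     (\<forall>i\<in>{1..<n}. \<forall>u\<in>V i. xb (x u) = x (xb u) + p (q u))}"

definition GV :: "('v \<Rightarrow> 'v) set" where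
  "GV = {g. Vector_Spaces.linear scV scV g \<and> bij g \<and> (\<forall>i. g ` V i = V i)}"

definition GV_act :: "('v \<Rightarrow> 'v) \<Rightarrow> ('v, 'd) quad \<Rightarrow> ('v, 'd) quad" where
  "GV_act g = (\<lambda>(x, xb, p, q). (g \<circ> x \<circ> inv g, g \<circ> xb \<circ> inv g, g \<circ> p, q \<circ> inv g))"

definition graded_subspace :: "'v set \<Rightarrow> bool" where
  "graded_subspace S \<longleftrightarrow> vs.subspace S \<and> (\<forall>u\<in>S. \<forall>i. component n V i u \<in> S)"

definition stable :: "('v, 'd) quad \<Rightarrow> bool" where
  "stable = (\<lambda>(x, xb, p, q).
     \<not> (\<exists>S. graded_subspace S \<and> S \<noteq> UNIV \<and> range p \<subseteq> S \<and> x ` S \<subseteq> S \<and> xb ` S \<subseteq> S))"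

definition costable :: "('v, 'd) quad \<Rightarrow> bool" where
  "costable = (\<lambda>(x, xb, p, q).
     \<not> (\<exists>S. graded_subspace S \<and> S \<noteq> {0} \<and> S \<subseteq> {u. q u = 0} \<and> x ` S \<subseteq> S \<and> xb ` S \<subseteq> S))"

definition Mreg :: "('v, 'd) quad set set" where
  "Mreg = (\<lambda>Q. (\<lambda>g. GV_act g Q) ` GV) ` {Q \<in> M0. stable Q \<and> costable Q}"

definition quad_coords :: "(('v, 'd) quad \<Rightarrow> complex) set" where
  "quad_coords =
     {(\<lambda>(x, xb, p, q). l (x u)) | l u. Vector_Spaces.linear scV (*) l} \<union>
     {(\<lambda>(x, xb, p, q). l (xb u)) | l u. Vector_Spaces.linear scV (*) l} \<union>
     {(\<lambda>(x, xb, p, q). l (p a)) | l a. Vector_Spaces.linear scV (*) l} \<union>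
     {(\<lambda>(x, xb, p, q). l (q u)) | l u. Vector_Spaces.linear scD (*) l}"

definition invariants :: "(('v, 'd) quad \<Rightarrow> complex) set" where
  "invariants = {f \<in> (\<lambda>f. restrict f M0) ` polyfun quad_coords.
     \<forall>g\<in>GV. \<forall>Q\<in>M0. f (GV_act g Q) = f Q}"

text \<open>
  The closed points of the spectrum of the invariants are the algebra homomorphisms to the complex
  numbers; their coordinates are the values at the invariants.
\<close>

definition spec_points :: "((('v, 'd) quad \<Rightarrow> complex) \<Rightarrow> complex) set" where
  "spec_points = {\<chi> \<in> extensional invariants.
     (\<forall>c. \<chi> (restrict (\<lambda>_. c) M0) = c) \<and>
     (\<forall>f\<in>invariants. \<forall>h\<in>invariants.
        \<chi> (restrict (\<lambda>Q. f Q + h Q) M0) = \<chi> f + \<chi> h \<and>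
        \<chi> (restrict (\<lambda>Q. f Q * h Q) M0) = \<chi> f * \<chi> h)}"

definition M00 ::
    "((('v, 'd) quad \<Rightarrow> complex) \<Rightarrow> complex, (('v, 'd) quad \<Rightarrow> complex) \<Rightarrow> complex) variety" where
  "M00 = affine_variety ((\<lambda>f \<chi>. \<chi> f) ` invariants) spec_points"

definition quot_map :: "('v, 'd) quad \<Rightarrow> (('v, 'd) quad \<Rightarrow> complex) \<Rightarrow> complex" where
  "quot_map Q = restrict (\<lambda>f. f Q) invariants"

subsection \<open>Lattices and the affine Grassmannian\<close>

text \<open>
  The second definition is \<open>\<Oplus> z\<^sup>-\<^sup>i D\<^sub>i[[z]]\<close>, which is \<open>lattice\<close> at \<open>\<lambda>\<close> because \<open>e\<close> is adapted.
\<close>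

definition lattice :: "(nat \<Rightarrow> int) \<Rightarrow> 'd series set" where
  "lattice \<eta> = {w. \<forall>t. w t \<in> ds.span (e ` {j. j < length (lambda_part n d) \<and> - \<eta> j \<le> t})}"

definition L_lambda :: "'d series set" where
  "L_lambda = {w. \<forall>t. w t \<in> ds.span (\<Union>i\<in>{i. 1 \<le> i \<and> i < n \<and> - int i \<le> t}. D i)}"

definition L_mu :: "'d series set" where
  "L_mu = lattice (\<lambda>j. int (mu_part n v d ! j))"

definition linear_series :: "int set \<Rightarrow> (int \<Rightarrow> 'd \<Rightarrow> 'd) set" where
  "linear_series K = {g. (\<forall>k. Vector_Spaces.linear scD scD (g k)) \<and> (\<forall>k. k \<notin> K \<longrightarrow> g k = (\<lambda>_. 0))}"

definition loop_nonneg :: "(int \<Rightarrow> 'd \<Rightarrow> 'd) set" where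
  "loop_nonneg = {g \<in> linear_series {0..}. \<exists>h\<in>linear_series {0..}.
     series_mult g h = series_one \<and> series_mult h g = series_one}"

definition loop_neg :: "(int \<Rightarrow> 'd \<Rightarrow> 'd) set" where
  "loop_neg = {g \<in> (\<Union>N. linear_series {- int N..0}). g 0 = (\<lambda>a. a) \<and>
     (\<exists>h \<in> (\<Union>N. linear_series {- int N..0}).
       series_mult g h = series_one \<and> series_mult h g = series_one)}"

definition lattice_orbit :: "(int \<Rightarrow> 'd \<Rightarrow> 'd) set \<Rightarrow> 'd series set \<Rightarrow> 'd series set set" where
  "lattice_orbit H L = (\<lambda>g. series_act g ` L) ` H"

text \<open>
  A lattice \<open>L\<close> with \<open>z\<^sup>N L\<^sub>0 \<subseteq> L \<subseteq> z\<^sup>-\<^sup>N L\<^sub>0\<close> and \<open>dim L / z\<^sup>N L\<^sub>0 = k\<close> is presented by the frames of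
  \<open>L / z\<^sup>N L\<^sub>0\<close>, with representatives supported in degrees \<open>-N \<le> t < N\<close>. Testing closedness for all
  \<open>N\<close> and \<open>k\<close> gives the topology of the ind-variety.
\<close>

definition frame_lattice :: "nat \<Rightarrow> nat \<Rightarrow> (nat \<Rightarrow> 'd series) \<Rightarrow> 'd series set" where
  "frame_lattice N k w =
     {u + (\<Sum>s<k. (\<lambda>t. scD (c s) (w s t))) | u c. u \<in> zpow_L0 (int N)}"

definition frames :: "nat \<Rightarrow> nat \<Rightarrow> (nat \<Rightarrow> 'd series) set" where
  "frames N k = {w.
     (\<forall>s t. k \<le> s \<or> t < - int N \<or> int N \<le> t \<longrightarrow> w s t = 0) \<and>
     (\<forall>c. (\<Sum>s<k. (\<lambda>t. scD (c s) (w s t))) = 0 \<longrightarrow> (\<forall>s<k. c s = 0)) \<and>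
     zpow 1 ` frame_lattice N k w \<subseteq> frame_lattice N k w}"

definition affine_Grassmannian :: "(nat \<Rightarrow> 'd series, 'd series set) variety" where
  "affine_Grassmannian =
     ({(\<lambda>w. l (w s t)) | l s t. Vector_Spaces.linear scD (*) l},
      {(frames N k, frame_lattice N k) | N k. True})"

definition Gr_slice :: "(nat \<Rightarrow> 'd series, 'd series set) variety" where
  "Gr_slice = subvariety affine_Grassmannian
     (lattice_orbit loop_neg L_lambda \<inter>
      zariski_closure affine_Grassmannian (lattice_orbit loop_nonneg L_mu))"

subsection \<open>The nilpotent slice\<close>

text \<open>
  \<open>Dt\<close> is the space of the polar parts of elements of \<open>L_lambda\<close>: the copy \<open>D\<^sub>j\<^sup>(\<^sup>k\<^sup>)\<close> is \<open>z\<^sup>-\<^sup>k D\<^sub>j\<close>, and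
  \<open>polar_part\<close> is the projection from \<open>L_lambda\<close> to its quotient by \<open>L\<^sub>0\<close>.
\<close>

definition Dt :: "'d series set" where
  "Dt = {w. \<forall>t. w t \<in> ds.span (\<Union>j\<in>{j. j < n \<and> 1 \<le> - t \<and> - t \<le> int j}. D j)}"

definition End_Dt :: "('d series \<Rightarrow> 'd series) set" where
  "End_Dt = {A \<in> Dt \<rightarrow>\<^sub>E Dt. \<forall>u\<in>Dt. \<forall>w\<in>Dt. \<forall>c.
     A (\<lambda>t. u t + scD c (w t)) = (\<lambda>t. A u t + scD c (A w t))}"

definition End_variety :: "('d series \<Rightarrow> 'd series, 'd series \<Rightarrow> 'd series) variety" where
  "End_variety = affine_variety
     {(\<lambda>A. l (A w t)) | l w t. w \<in> Dt \<and> Vector_Spaces.linear scD (*) l} End_Dt"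

definition shift :: "'d series \<Rightarrow> 'd series" where
  "shift w = polar_part (zpow 1 w)"

definition C_space :: "('d series \<Rightarrow> 'd series) set" where
  "C_space = {B \<in> End_Dt.
     \<forall>j' j h' h. 1 \<le> h' \<and> h' \<le> j' \<and> j' < n \<and> 1 \<le> h \<and> h \<le> j \<and> j < n \<and> \<not> (h = j \<and> h' \<le> j) \<longrightarrow>
       (\<forall>a\<in>D j'. component n D j (B (monomial (- int h') a) (- int h)) = 0)}"

definition T_lambda :: "('d series \<Rightarrow> 'd series) set" where
  "T_lambda = (\<lambda>B. restrict (\<lambda>w. shift w + B w) Dt) ` C_space"

text \<open>Operators with a Jordan basis with eigenvalue 0 and blocks of sizes \<open>mu_part\<close>.\<close>

definition O_mu :: "('d series \<Rightarrow> 'd series) set" where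
  "O_mu = {A \<in> End_Dt. \<exists>b :: nat \<Rightarrow> nat \<Rightarrow> 'd series.
     let \<mu> = mu_part n v d; I = {(s, t). s < length \<mu> \<and> t < \<mu> ! s} in
       (\<forall>(s, t) \<in> I. b s t \<in> Dt \<and> A (b s t) = (if t = 0 then 0 else b s (t - 1))) \<and>
       (\<forall>w\<in>Dt. \<exists>!c. c \<in> extensional I \<and> w = (\<Sum>(s, t)\<in>I. (\<lambda>k. scD (c (s, t)) (b s t k))))}"

definition T_slice :: "('d series \<Rightarrow> 'd series, 'd series \<Rightarrow> 'd series) variety" where
  "T_slice = subvariety End_variety (T_lambda \<inter> zariski_closure End_variety O_mu)"

subsection \<open>The explicit formulas\<close>

text \<open>
  Powers of the total maps restrict to the composites along the quiver, e.g. \<open>x ^^ (j - h')\<close> is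
  \<open>x\<^sub>j\<^sub>-\<^sub>1 \<cdots> x\<^sub>h\<^sub>'\<close> on \<open>V\<^sub>h\<^sub>'\<close>. Blocks with \<open>h' > j'\<close> do not occur.
\<close>

definition f1 :: "('v, 'd) quad \<Rightarrow> 'd series \<Rightarrow> 'd series" where
  "f1 = (\<lambda>(x, xb, p, q) w.
     \<Sum>j = 1..<n. \<Sum>j' = 1..<n. \<Sum>h' = 1..min j j'.
       monomial (- int j)
         (q ((x ^^ (j - h')) ((xb ^^ (j' - h')) (p (component n D j' (w (- int h'))))))))"

definition phi_formula :: "('v, 'd) quad \<Rightarrow> 'd series \<Rightarrow> 'd series" where
  "phi_formula Q = restrict (\<lambda>w. shift w + f1 Q w) Dt"

definition psi_formula :: "('d series \<Rightarrow> 'd series) \<Rightarrow> 'd series set" where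
  "psi_formula A =
     (let f = (\<lambda>w. A (polar_part w) - shift (polar_part w)) in
      (\<lambda>w. w + Sum_any (\<lambda>k. if k \<ge> 1
          then zpow (- int k) (f (((\<lambda>u. zpow 1 u + f u) ^^ (k - 1)) w)) else 0)) ` L_lambda)"

definition composite_formula :: "('v, 'd) quad \<Rightarrow> 'd series set" where
  "composite_formula = (\<lambda>(x, xb, p, q).
     (\<lambda>w. w + zpow (- 1) (Sum_any (\<lambda>(r, l).
        zpow (- int l) (\<lambda>t. q ((xb ^^ r) ((x ^^ l) (p (w t)))))))) ` L_lambda)"

end

end

theory Submission
  imports Defs
begin

text \<open>
  On series with coefficients in \<open>V\<close> put \<open>a = (1 - xb)\<inverse>\<close> and \<open>b = (z - x)\<inverse>\<close>; both are finite sums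
  because \<open>x\<close> and \<open>xb\<close> shift the grading. The composite formula is the image of \<open>L_lambda\<close> under
  \<open>w \<mapsto> w + q a b p w\<close>. The moment map equation says that \<open>p q\<close> is the commutator of \<open>1 - xb\<close> and
  \<open>z - x\<close>; it makes the series defining \<open>\<psi>\<close> telescope to \<open>w \<mapsto> w + q a b \<delta>\<close>, where \<open>\<delta> = \<Phi> w\<close> lies in
  \<open>\<Oplus> z\<^sup>-\<^sup>i V\<^sub>i\<close> and is the unique such element with \<open>p w - \<delta>\<close> in the image under \<open>1 - xb\<close> of the series
  whose coefficients of \<open>z\<^sup>t\<close> lie in the sum of the \<open>V\<^sub>i\<close> with \<open>i > -t\<close>. The two maps differ on \<open>L_lambda\<close> but have the same
  image: one passes between preimages by adding or subtracting \<open>q y\<close>, with \<open>y\<close> a series whose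
  coefficients of \<open>z\<^sup>t\<close> lie in the sum of the \<open>V\<^sub>i\<close> with \<open>i \<ge> -t\<close>.
\<close>

section \<open>Composition of isomorphisms; additive maps\<close>

lemma variety_iso_comp:
  assumes F: "variety_iso X X' F" and G: "variety_iso X' X'' G"
  shows "variety_iso X X'' (G \<circ> F)"
proof -
  have bij: "bij_betw F (points X) (points X')"
    and op: "\<And>U. U \<subseteq> points X \<Longrightarrow> zariski_open X U \<longleftrightarrow> zariski_open X' (F ` U)"
    and reg: "\<And>U g. zariski_open X U \<Longrightarrow> regular_on X' (F ` U) g \<longleftrightarrow> regular_on X U (g \<circ> F)"
    using F unfolding variety_iso_def by blast+
  have bij': "bij_betw G (points X') (points X'')"
    and op': "\<And>U. U \<subseteq> points X' \<Longrightarrow> zariski_open X' U \<longleftrightarrow> zariski_open X'' (G ` U)"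
    and reg': "\<And>U g. zariski_open X' U \<Longrightarrow> regular_on X'' (G ` U) g \<longleftrightarrow> regular_on X' U (g \<circ> G)"
    using G unfolding variety_iso_def by blast+
  have sub: "F ` U \<subseteq> points X'" if "U \<subseteq> points X" for U
    using bij that by (auto simp: bij_betw_def)
  have "zariski_open X U \<longleftrightarrow> zariski_open X'' ((G \<circ> F) ` U)" if "U \<subseteq> points X" for U
    using op[OF that] op'[OF sub[OF that]] by (simp add: image_comp)
  moreover have "regular_on X'' ((G \<circ> F) ` U) g \<longleftrightarrow> regular_on X U (g \<circ> (G \<circ> F))"
    if "zariski_open X U" for U g
  proof -
    have "zariski_open X' (F ` U)"
      using that op[of U] by (auto simp: zariski_open_def)
    from reg'[OF this, of g] reg[OF that, of "g \<circ> G"] show ?thesis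
      by (simp only: image_comp comp_assoc)
  qed
  ultimately show ?thesis
    using bij_betw_trans[OF bij bij'] unfolding variety_iso_def by blast
qed

lemma additive_funpow: "additive f \<Longrightarrow> additive (f ^^ k)"
  for f :: "'a::ab_group_add \<Rightarrow> 'a"
  by (induction k) (auto simp: additive_def)

lemma sum_fun_apply: "(\<Sum>k\<in>A. f k) t = (\<Sum>k\<in>A. f k t)"
  for f :: "'k \<Rightarrow> 'a \<Rightarrow> 'b::comm_monoid_add"
  by (induction A rule: infinite_finite_induct) auto

section \<open>Gradings given by projections, and the degree filtration on series\<close>

locale grading =
  fixes n :: nat and c :: "nat \<Rightarrow> 'a::ab_group_add \<Rightarrow> 'a"
  assumes additive_c: "additive (c i)"
    and c_outside: "i \<notin> {1..<n} \<Longrightarrow> c i u = 0"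
    and c_c: "c i (c j u) = (if i = j then c i u else 0)"
    and sum_c: "(\<Sum>i = 1..<n. c i u) = u"
begin

lemmas c_simps = additive.add[OF additive_c] additive.diff[OF additive_c]
  additive.zero[OF additive_c] additive.sum[OF additive_c]

lemma eq_zeroI: "(\<And>i. c i u = 0) \<Longrightarrow> u = 0"
  using sum_c[of u] by simp

text \<open>The degree of \<open>u z\<^sup>t\<close> with \<open>u\<close> in the \<open>i\<close>-th summand is \<open>i + t\<close>; so \<open>L_lambda\<close> is \<open>filtered 0\<close>.\<close>

definition filtered :: "int \<Rightarrow> 'a series set" where
  "filtered k = {y. \<forall>t i. int i + t < k \<longrightarrow> c i (y t) = 0}"

definition homogeneous :: "'a series set" where
  "homogeneous = {y. \<forall>t i. int i + t \<noteq> 0 \<longrightarrow> c i (y t) = 0}"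

lemma filtered_add: "y \<in> filtered k \<Longrightarrow> w \<in> filtered k \<Longrightarrow> y + w \<in> filtered k"
  and filtered_diff: "y \<in> filtered k \<Longrightarrow> w \<in> filtered k \<Longrightarrow> y - w \<in> filtered k"
  and filtered_mono: "y \<in> filtered k \<Longrightarrow> l \<le> k \<Longrightarrow> y \<in> filtered l"
  and homogeneous_filtered: "y \<in> homogeneous \<Longrightarrow> y \<in> filtered 0"
  by (auto simp: filtered_def homogeneous_def c_simps)

lemma filtered_zpow: "y \<in> filtered k \<Longrightarrow> zpow m y \<in> filtered (k + m)"
  by (auto simp: filtered_def zpow_def)

text \<open>Each coefficient is cut at degree 0. In \<open>composite_subset_psi\<close> the upper
  part corrects the preimage by \<open>q\<close>, and the lower part carries the homogeneous
  remainder.\<close>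

lemma split_filtered:
  obtains y' y'' where "y = y' + y''" "y' \<in> filtered 0"
    "\<And>t i. int i + t \<ge> 0 \<Longrightarrow> c i (y'' t) = 0"
proof -
  define y' where "y' = (\<lambda>t. \<Sum>i \<in> {i \<in> {1..<n}. int i + t \<ge> 0}. c i (y t))"
  have *: "c i (y' t) = (if int i + t \<ge> 0 then c i (y t) else 0)" for i t
    unfolding y'_def c_simps c_c
    by (cases "i \<in> {1..<n}") (auto simp: sum.delta c_outside)
  show thesis
    by (rule that[of y' "y - y'"]) (auto simp: filtered_def * c_simps)
qed

end

section \<open>Graded representations and the inverses of \<open>z - x\<close> and
  \<open>1 - xb\<close>\<close>

locale quiver_rep =
  V: grading n cV + D: grading n cD
  for n :: nat and cV :: "nat \<Rightarrow> 'v::ab_group_add \<Rightarrow> 'v"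
    and cD :: "nat \<Rightarrow> 'd::ab_group_add \<Rightarrow> 'd" +
  fixes x xb :: "'v \<Rightarrow> 'v" and p :: "'d \<Rightarrow> 'v" and q :: "'v \<Rightarrow> 'd"
  assumes additive_x: "additive x" and additive_xb: "additive xb"
    and additive_p: "additive p" and additive_q: "additive q"
    and c_x: "cV (Suc i) (x u) = x (cV i u)"
    and c_xb: "cV i (xb u) = xb (cV (Suc i) u)"
    and c_p: "cV i (p a) = p (cD i a)"
    and c_q: "cD i (q u) = q (cV i u)"
    and moment: "xb (x u) = x (xb u) + p (q u)"
begin

lemmas op_simps =
  additive.add[OF additive_x] additive.diff[OF additive_x] additive.zero[OF additive_x]
  additive.sum[OF additive_x]
  additive.add[OF additive_xb] additive.diff[OF additive_xb] additive.zero[OF additive_xb]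
  additive.sum[OF additive_xb]
  additive.add[OF additive_p] additive.diff[OF additive_p] additive.zero[OF additive_p]
  additive.sum[OF additive_p]
  additive.add[OF additive_q] additive.diff[OF additive_q] additive.zero[OF additive_q]
  additive.sum[OF additive_q]

lemmas pow_x_simps = additive.add[OF additive_funpow[OF additive_x]]
  additive.diff[OF additive_funpow[OF additive_x]] additive.zero[OF additive_funpow[OF additive_x]]
  additive.sum[OF additive_funpow[OF additive_x]]

lemmas pow_xb_simps = additive.add[OF additive_funpow[OF additive_xb]]
  additive.diff[OF additive_funpow[OF additive_xb]] additive.zero[OF additive_funpow[OF additive_xb]]
  additive.sum[OF additive_funpow[OF additive_xb]]

text \<open>The case \<open>l > i\<close> is split off so that truncated subtraction never names a
  wrong source: no summand is sent by \<open>x ^^ l\<close> to the \<open>i\<close>-th one.\<close>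

lemma c_pow_x: "cV i ((x ^^ l) u) = (if l \<le> i then (x ^^ l) (cV (i - l) u) else 0)"
proof (induction l arbitrary: i)
  case (Suc l)
  show ?case
  proof (cases i)
    case 0
    then show ?thesis by (simp add: V.c_outside)
  next
    case (Suc j)
    then show ?thesis using Suc.IH[of j] by (simp add: c_x op_simps)
  qed
qed simp

lemma c_pow_xb: "cV i ((xb ^^ r) u) = (xb ^^ r) (cV (i + r) u)"
  by (induction r arbitrary: i) (auto simp: c_xb)

text \<open>Only the indices below \<open>n\<close> carry a nonzero summand, and \<open>n\<close>
  steps lead out of that range. This and its analogue for \<open>xb\<close> let all geometric series
  stop at \<open>n\<close>.\<close>

lemma pow_x_zero: "n \<le> l \<Longrightarrow> (x ^^ l) u = 0"
proof (rule V.eq_zeroI)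
  show "cV i ((x ^^ l) u) = 0" if "n \<le> l" for i
    using that by (cases "i < n") (simp add: c_pow_x, simp add: V.c_outside)
qed

lemma pow_xb_zero: "n \<le> r \<Longrightarrow> (xb ^^ r) u = 0"
  by (rule V.eq_zeroI) (auto simp: c_pow_xb V.c_outside pow_xb_simps)

definition z_sub_x :: "'v series \<Rightarrow> 'v series" where
  "z_sub_x w = (\<lambda>t. w (t - 1) - x (w t))"

definition one_sub_xb :: "'v series \<Rightarrow> 'v series" where
  "one_sub_xb w = (\<lambda>t. w t - xb (w t))"

text \<open>The inverse is expanded in negative powers of \<open>z\<close>, as the sum of
  \<open>z^(-l-1) x^l\<close>; hence the argument \<open>t + 1 + int l\<close>.\<close>

definition inv_z_sub_x :: "'v series \<Rightarrow> 'v series" where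
  "inv_z_sub_x w = (\<lambda>t. \<Sum>l<n. (x ^^ l) (w (t + 1 + int l)))"

definition inv_one_sub_xb :: "'v series \<Rightarrow> 'v series" where
  "inv_one_sub_xb w = (\<lambda>t. \<Sum>r<n. (xb ^^ r) (w t))"

lemma z_sub_x_inv: "z_sub_x (inv_z_sub_x w) = w"
proof
  fix t
  have "z_sub_x (inv_z_sub_x w) t =
      (\<Sum>l<n. (x ^^ l) (w (t + int l)) - (x ^^ Suc l) (w (t + int (Suc l))))"
    by (simp add: z_sub_x_def inv_z_sub_x_def op_simps sum_subtractf algebra_simps)
  also have "\<dots> = w t"
    by (subst sum_lessThan_telescope') (simp add: pow_x_zero)
  finally show "z_sub_x (inv_z_sub_x w) t = w t" .
qed

lemma inv_z_sub_x: "inv_z_sub_x (z_sub_x w) = w"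
proof
  fix t
  have "inv_z_sub_x (z_sub_x w) t =
      (\<Sum>l<n. (x ^^ l) (w (t + int l)) - (x ^^ Suc l) (w (t + int (Suc l))))"
    by (simp add: z_sub_x_def inv_z_sub_x_def pow_x_simps funpow_swap1 algebra_simps)
  also have "\<dots> = w t"
    by (subst sum_lessThan_telescope') (simp add: pow_x_zero)
  finally show "inv_z_sub_x (z_sub_x w) t = w t" .
qed

lemma one_sub_xb_inv: "one_sub_xb (inv_one_sub_xb w) = w"
proof
  fix t
  have "one_sub_xb (inv_one_sub_xb w) t = (\<Sum>r<n. (xb ^^ r) (w t) - (xb ^^ Suc r) (w t))"
    by (simp add: one_sub_xb_def inv_one_sub_xb_def op_simps sum_subtractf)
  also have "\<dots> = w t"
    by (subst sum_lessThan_telescope') (simp add: pow_xb_zero)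
  finally show "one_sub_xb (inv_one_sub_xb w) t = w t" .
qed

lemma inv_one_sub_xb: "inv_one_sub_xb (one_sub_xb w) = w"
proof
  fix t
  have "inv_one_sub_xb (one_sub_xb w) t = (\<Sum>r<n. (xb ^^ r) (w t) - (xb ^^ Suc r) (w t))"
    by (simp add: one_sub_xb_def inv_one_sub_xb_def pow_xb_simps funpow_swap1)
  also have "\<dots> = w t"
    by (subst sum_lessThan_telescope') (simp add: pow_xb_zero)
  finally show "inv_one_sub_xb (one_sub_xb w) t = w t" .
qed

lemma z_sub_x_add: "z_sub_x (u + w) = z_sub_x u + z_sub_x w"
  and one_sub_xb_add: "one_sub_xb (u + w) = one_sub_xb u + one_sub_xb w"
  by (auto simp: z_sub_x_def one_sub_xb_def op_simps)

lemma commutator: "one_sub_xb (z_sub_x w) = z_sub_x (one_sub_xb w) + (p \<circ> q \<circ> w)"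
  by (auto simp: one_sub_xb_def z_sub_x_def op_simps moment algebra_simps)

lemma filtered_x: "y \<in> V.filtered k \<Longrightarrow> x \<circ> y \<in> V.filtered (k + 1)"
proof -
  assume y: "y \<in> V.filtered k"
  have "cV i (x (y t)) = 0" if "int i + t < k + 1" for i t
    using that y by (cases i) (auto simp: V.c_outside c_x V.filtered_def op_simps)
  then show ?thesis by (simp add: V.filtered_def)
qed

lemma filtered_xb: "y \<in> V.filtered k \<Longrightarrow> xb \<circ> y \<in> V.filtered (k - 1)"
  by (auto simp: V.filtered_def c_xb op_simps)

lemma filtered_p: "w \<in> D.filtered k \<Longrightarrow> p \<circ> w \<in> V.filtered k"
  and filtered_q: "y \<in> V.filtered k \<Longrightarrow> q \<circ> y \<in> D.filtered k"
  by (auto simp: V.filtered_def D.filtered_def c_p c_q op_simps)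

lemma z_sub_x_alt: "z_sub_x y = zpow 1 y - (x \<circ> y)"
  and one_sub_xb_alt: "one_sub_xb y = y - (xb \<circ> y)"
  by (auto simp: z_sub_x_def one_sub_xb_def zpow_def)

lemma filtered_z_sub_x: "y \<in> V.filtered k \<Longrightarrow> z_sub_x y \<in> V.filtered (k + 1)"
  unfolding z_sub_x_alt by (intro V.filtered_diff V.filtered_zpow filtered_x)

lemma filtered_one_sub_xb: "y \<in> V.filtered k \<Longrightarrow> one_sub_xb y \<in> V.filtered (k - 1)"
  unfolding one_sub_xb_alt
  by (intro V.filtered_diff filtered_xb) (auto elim: V.filtered_mono)

text \<open>Every term \<open>z^(-l-1) x^l\<close> lowers the degree by exactly 1:
  \<open>x ^^ l\<close> raises it by \<open>l\<close> and the power of \<open>z\<close> lowers it by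
  \<open>l + 1\<close>.\<close>

lemma filtered_inv_z_sub_x: "y \<in> V.filtered k \<Longrightarrow> inv_z_sub_x y \<in> V.filtered (k - 1)"
  by (auto simp: V.filtered_def inv_z_sub_x_def V.c_simps c_pow_x pow_x_simps intro!: sum.neutral)

section \<open>Homogeneous normal form of \<open>p w\<close> modulo the image of
  \<open>1 - xb\<close>\<close>

definition reduces :: "'d series \<Rightarrow> 'v series \<Rightarrow> bool" where
  "reduces w \<delta> \<longleftrightarrow> w \<in> D.filtered 0 \<and> \<delta> \<in> V.homogeneous \<and>
     (\<exists>u \<in> V.filtered 1. p \<circ> w = \<delta> + one_sub_xb u)"

text \<open>The difference \<open>k\<close> of the two correction terms has degrees at least 1,
  while \<open>(1 - xb) k\<close> is homogeneous of degree 0. Nilpotency of \<open>xb\<close> kills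
  \<open>k\<close> in degree 1, and then nothing is left in degree 0. Uniqueness allows
  \<open>Phi\<close> of a transformed series to be found by exhibiting a normal form.\<close>

lemma reduces_unique:
  assumes "reduces w \<delta>" "reduces w \<delta>'"
  shows "\<delta> = \<delta>'"
proof -
  obtain u u' where u: "u \<in> V.filtered 1" "u' \<in> V.filtered 1"
    and eq: "\<delta> + one_sub_xb u = \<delta>' + one_sub_xb u'"
    and hom: "\<delta> \<in> V.homogeneous" "\<delta>' \<in> V.homogeneous"
    using assms unfolding reduces_def by metis
  have "cV i (\<delta> t) = cV i (\<delta>' t)" for i t
  proof (cases "int i + t = 0")
    case True
    define k where "k = u' - u"
    have k1: "k \<in> V.filtered 1" unfolding k_def using u by (intro V.filtered_diff)
    have kx: "k t - xb (k t) = \<delta> t - \<delta>' t" for t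
      using fun_cong[OF eq, of t] by (simp add: k_def one_sub_xb_def op_simps algebra_simps)
    \<comment> \<open>In positive degrees the normal forms vanish, so there \<open>k\<close> equals
      its image under \<open>xb\<close> from one index higher. Iterating \<open>n\<close> times
      gives zero.\<close>
    have down: "cV (Suc i) (k t) = (xb ^^ m) (cV (Suc i + m) (k t))" for m
    proof (induction m)
      case (Suc m)
      have "cV (Suc i + m) (\<delta> t) = 0" "cV (Suc i + m) (\<delta>' t) = 0"
        using hom True by (auto simp: V.homogeneous_def)
      then have "cV (Suc i + m) (k t) = xb (cV (Suc i + Suc m) (k t))"
        using arg_cong[OF kx[of t], of "cV (Suc i + m)"] by (simp add: V.c_simps c_xb)
      then show ?case using Suc by (simp add: funpow_swap1)
    qed simp
    have "cV (Suc i) (k t) = 0"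
      using down[of n] by (simp add: pow_xb_zero)
    moreover have "cV i (k t) = 0"
      using k1 True by (simp add: V.filtered_def)
    ultimately show ?thesis
      using arg_cong[OF kx[of t], of "cV i"] by (simp add: V.c_simps c_xb op_simps)
  next
    case False
    then show ?thesis using hom by (simp add: V.homogeneous_def)
  qed
  then have "cV i (\<delta> t - \<delta>' t) = 0" for i t by (simp add: V.c_simps)
  then have "\<delta> t - \<delta>' t = 0" for t by (rule V.eq_zeroI)
  then show ?thesis by (simp add: fun_eq_iff)
qed


text \<open>
  On \<open>z\<^sup>-\<^sup>h D\<^sub>j\<close> this is \<open>z\<^sup>-\<^sup>h xb\<^bsup>j - h\<^esup> p\<close>, the right factor of \<open>f1\<close>; see \<open>f1_eq_resolvent\<close>.
\<close>

definition Phi :: "'d series \<Rightarrow> 'v series" where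
  "Phi w = (\<lambda>t. if t < 0 then (\<Sum>j = nat (- t)..<n. (xb ^^ nat (int j + t)) (p (cD j (w t)))) else 0)"

text \<open>This makes the range of \<open>j\<close> independent of \<open>t\<close>. For
  \<open>t \<ge> 0\<close> the extra terms vanish, because \<open>xb ^^ (j + t)\<close> takes the
  \<open>j\<close>-th summand to an index at most 0.\<close>

lemma Phi_eq:
  "Phi w t = (\<Sum>j = 1..<n. if int j + t \<ge> 0 then (xb ^^ nat (int j + t)) (p (cD j (w t))) else 0)"
proof (cases "t < 0")
  case True
  then show ?thesis
    unfolding Phi_def by (auto intro!: sum.mono_neutral_cong_left)
next
  case False
  have "(xb ^^ nat (int j + t)) (p (cD j (w t))) = 0" for j
  proof (rule V.eq_zeroI)
    fix i
    show "cV i ((xb ^^ nat (int j + t)) (p (cD j (w t)))) = 0"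
    proof (cases "i = 0")
      case False
      then have "i + nat (int j + t) \<noteq> j" using \<open>\<not> t < 0\<close> by linarith
      then show ?thesis by (simp add: c_pow_xb c_p D.c_c op_simps pow_xb_simps)
    qed (simp add: V.c_outside)
  qed
  then show ?thesis using False by (simp add: Phi_def)
qed

lemma homogeneous_Phi: "Phi w \<in> V.homogeneous"
  unfolding V.homogeneous_def Phi_eq
  by (auto simp: V.c_simps c_pow_xb c_p D.c_c op_simps pow_xb_simps intro!: sum.neutral)

text \<open>On the \<open>j\<close>-th summand, \<open>1 - xb^(j+t)\<close> is \<open>1 - xb\<close>
  times the geometric sum over \<open>r < j + t\<close>. The terms of that sum have degree
  \<open>j + t - r\<close>, which is at least 1, so they form an admissible correction
  \<open>u\<close>.\<close>

lemma reduces_Phi: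
  assumes w: "w \<in> D.filtered 0"
  shows "reduces w (Phi w)"
proof -
  define u where "u = (\<lambda>t. \<Sum>j = 1..<n. \<Sum>r<nat (int j + t). (xb ^^ r) (p (cD j (w t))))"
  have u: "u \<in> V.filtered 1"
    unfolding V.filtered_def u_def
    by (auto simp: V.c_simps c_pow_xb c_p D.c_c op_simps pow_xb_simps intro!: sum.neutral)
  have "p (w t) = Phi w t + one_sub_xb u t" for t
  proof -
    have "one_sub_xb u t = (\<Sum>j = 1..<n. \<Sum>r<nat (int j + t).
        (xb ^^ r) (p (cD j (w t))) - (xb ^^ Suc r) (p (cD j (w t))))"
      unfolding one_sub_xb_def u_def by (simp add: op_simps sum_subtractf)
    also have "\<dots> = (\<Sum>j = 1..<n. p (cD j (w t)) - (xb ^^ nat (int j + t)) (p (cD j (w t))))"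
      by (subst sum_lessThan_telescope') simp
    \<comment> \<open>For \<open>j + t < 0\<close> the exponent truncates to 0 on the left, while
      the right side subtracts 0; the two agree because \<open>w\<close> has no such
      component.\<close>
    also have "\<dots> = (\<Sum>j = 1..<n. p (cD j (w t)) -
        (if int j + t \<ge> 0 then (xb ^^ nat (int j + t)) (p (cD j (w t))) else 0))"
      using w by (intro sum.cong) (auto simp: D.filtered_def op_simps)
    also have "\<dots> = p (w t) - Phi w t"
      using D.sum_c by (simp add: Phi_eq sum_subtractf flip: op_simps(12))
    finally show ?thesis by simp
  qed
  then have "p \<circ> w = Phi w + one_sub_xb u" by (auto simp: fun_eq_iff)
  then show ?thesis using w homogeneous_Phi u by (auto simp: reduces_def)
qed

section \<open>The two maps of series: equality of images, evaluation of the defining sums\<close>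

definition composite_map :: "'d series \<Rightarrow> 'd series" where
  "composite_map w = w + (q \<circ> inv_one_sub_xb (inv_z_sub_x (p \<circ> w)))"

definition psi_map :: "'d series \<Rightarrow> 'd series" where
  "psi_map w = w + (q \<circ> inv_one_sub_xb (inv_z_sub_x (Phi w)))"

text \<open>The correction \<open>u\<close> is absorbed by \<open>y1\<close>, its image under
  \<open>(z - x)^(-1)\<close>. Swapping the factors by \<open>commutator\<close> costs
  \<open>p q y1\<close>, which is compensated by passing from \<open>w\<close> to
  \<open>w - q y1\<close>; the two occurrences of \<open>q y1\<close> then cancel in
  \<open>composite_map w'\<close>.\<close>

lemma psi_subset_composite:
  assumes w: "w \<in> D.filtered 0"
  shows "\<exists>w' \<in> D.filtered 0. composite_map w' = psi_map w"
proof -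
  obtain u where u: "u \<in> V.filtered 1" and pw: "p \<circ> w = Phi w + one_sub_xb u"
    using reduces_Phi[OF w] by (auto simp: reduces_def)
  define y1 where "y1 = inv_z_sub_x u"
  define y2 where "y2 = inv_one_sub_xb (inv_z_sub_x (Phi w))"
  define w' where "w' = w - (q \<circ> y1)"
  have y1: "y1 \<in> V.filtered 0"
    using filtered_inv_z_sub_x[OF u] by (simp add: y1_def)
  have w': "w' \<in> D.filtered 0"
    unfolding w'_def using w y1 by (intro D.filtered_diff filtered_q)
  have "z_sub_x (one_sub_xb (y1 + y2)) = one_sub_xb u - (p \<circ> q \<circ> y1) + Phi w"
    using commutator[of y1]
    by (simp add: z_sub_x_add one_sub_xb_add y2_def one_sub_xb_inv z_sub_x_inv y1_def
        algebra_simps)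
  also have "\<dots> = p \<circ> w'"
    using pw by (auto simp: w'_def fun_eq_iff op_simps algebra_simps)
  finally have "inv_one_sub_xb (inv_z_sub_x (p \<circ> w')) = y1 + y2"
    by (metis inv_one_sub_xb inv_z_sub_x)
  then have "composite_map w' = psi_map w"
    by (auto simp: composite_map_def psi_map_def w'_def y2_def fun_eq_iff op_simps)
  then show ?thesis using w' by blast
qed

text \<open>The converse correction adds \<open>q y1\<close>, where \<open>y1\<close> is the part of
  \<open>y\<close> in nonnegative degrees. By \<open>commutator\<close>, the remaining part
  \<open>y2\<close> yields a normal form of \<open>p w'\<close>, which must be
  \<open>Phi w'\<close>.\<close>

lemma composite_subset_psi:
  assumes w: "w \<in> D.filtered 0"
  shows "\<exists>w' \<in> D.filtered 0. psi_map w' = composite_map w"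
proof -
  define y where "y = inv_one_sub_xb (inv_z_sub_x (p \<circ> w))"
  have y: "z_sub_x (one_sub_xb y) = p \<circ> w"
    by (simp add: y_def one_sub_xb_inv z_sub_x_inv)
  obtain y1 y2 where y12: "y = y1 + y2" and y1: "y1 \<in> V.filtered 0"
    and y2: "\<And>t i. int i + t \<ge> 0 \<Longrightarrow> cV i (y2 t) = 0"
    using V.split_filtered by blast
  define w' where "w' = w + (q \<circ> y1)"
  define \<delta> where "\<delta> = z_sub_x (one_sub_xb y2)"
  have w': "w' \<in> D.filtered 0"
    unfolding w'_def using w y1 by (intro D.filtered_add filtered_q)
  have \<delta>: "\<delta> = (p \<circ> w) - z_sub_x (one_sub_xb y1)"
    using y by (simp add: y12 \<delta>_def z_sub_x_add one_sub_xb_add algebra_simps)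
  have "\<delta> \<in> V.filtered 0"
    unfolding \<delta> using filtered_z_sub_x[OF filtered_one_sub_xb[OF y1]] w
    by (intro V.filtered_diff filtered_p) auto
  \<comment> \<open>\<open>y2\<close> lives in negative degrees and \<open>(z - x) (1 - xb)\<close>
    raises degrees by at most 1. Together with the lower bound just shown this leaves degree 0
    only.\<close>
  moreover have "cV i (\<delta> t) = 0" if "int i + t > 0" for i t
    using that y2 by (cases i) (auto simp: \<delta>_def z_sub_x_def one_sub_xb_def V.c_simps
        c_x c_xb op_simps V.c_outside)
  ultimately have hom: "\<delta> \<in> V.homogeneous"
    unfolding V.homogeneous_def V.filtered_def by (auto simp: neq_iff)
  have "p \<circ> w' = \<delta> + one_sub_xb (z_sub_x y1)"
    unfolding commutator \<delta> by (auto simp: w'_def fun_eq_iff op_simps)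
  then have "reduces w' \<delta>"
    using w' hom filtered_z_sub_x[OF y1] by (auto simp: reduces_def)
  then have "Phi w' = \<delta>"
    using reduces_unique reduces_Phi[OF w'] by blast
  then have "psi_map w' = composite_map w"
    by (simp add: psi_map_def \<delta>_def inv_z_sub_x inv_one_sub_xb composite_map_def flip: y_def)
      (auto simp: y12 w'_def fun_eq_iff op_simps)
  then show ?thesis using w' by blast
qed

lemma psi_image_eq_composite_image: "psi_map ` D.filtered 0 = composite_map ` D.filtered 0"
  by (intro equalityI image_subsetI) (metis psi_subset_composite imageI, metis composite_subset_psi imageI)

text \<open>This is one step of \<open>z + f\<close>, followed on normal forms. Writing
  \<open>\<delta>\<close> for \<open>z_sub_x \<gamma>\<close>, the moment equation gives
  \<open>z p q \<gamma> = z (z - x) xb \<gamma> - z xb \<delta>\<close>, so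
  \<open>z (\<delta> + u)\<close> serves as the new correction term.\<close>

lemma reduces_step:
  assumes r: "reduces w (z_sub_x \<gamma>)"
  shows "reduces (zpow 1 w + (q \<circ> zpow 1 \<gamma>)) (z_sub_x (zpow 1 (xb \<circ> \<gamma>)))"
proof -
  let ?\<delta> = "z_sub_x \<gamma>" and ?w = "zpow 1 w + (q \<circ> zpow 1 \<gamma>)"
    and ?\<delta>' = "z_sub_x (zpow 1 (xb \<circ> \<gamma>))"
  obtain u where w: "w \<in> D.filtered 0" and hom: "?\<delta> \<in> V.homogeneous"
    and u: "u \<in> V.filtered 1" and pw: "p \<circ> w = ?\<delta> + one_sub_xb u"
    using r by (auto simp: reduces_def)
  have "p (?w t) = ?\<delta>' t + one_sub_xb (zpow 1 (?\<delta> + u)) t" for t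
    using fun_cong[OF pw, of "t - 1"]
    by (simp add: z_sub_x_def one_sub_xb_def zpow_def op_simps moment algebra_simps)
  then have "p \<circ> ?w = ?\<delta>' + one_sub_xb (zpow 1 (?\<delta> + u))"
    by (auto simp: fun_eq_iff)
  moreover have "zpow 1 (?\<delta> + u) \<in> V.filtered 1"
    using V.filtered_zpow[OF V.filtered_add[OF V.homogeneous_filtered[OF hom]], of u 1]
      V.filtered_mono[OF u, of 0] by simp
  \<comment> \<open>\<open>\<gamma>\<close> is recovered from the homogeneous
    \<open>(z - x) \<gamma>\<close> by an inverse of degree -1, so it sits in degree -1.\<close>
  moreover have \<gamma>: "cV i (\<gamma> t) = 0" if "int i + t + 1 \<noteq> 0" for i t
  proof -
    have "cV i (inv_z_sub_x ?\<delta> t) = 0"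
      using that hom by (auto simp: inv_z_sub_x_def V.homogeneous_def V.c_simps c_pow_x
          pow_x_simps intro!: sum.neutral)
    then show ?thesis by (simp add: inv_z_sub_x)
  qed
  moreover have "?\<delta>' \<in> V.homogeneous"
    unfolding V.homogeneous_def
  proof (intro CollectI allI impI)
    fix t i assume "int i + t \<noteq> 0"
    then show "cV i (?\<delta>' t) = 0"
      by (cases i) (auto simp: z_sub_x_def zpow_def V.c_simps c_x c_xb \<gamma> op_simps V.c_outside)
  qed
  moreover have "?w \<in> D.filtered 0"
  proof -
    have "zpow 1 \<gamma> \<in> V.filtered 0"
      by (auto simp: V.filtered_def zpow_def intro!: \<gamma>)
    then show ?thesis
      using D.filtered_zpow[OF w, of 1]
      by (intro D.filtered_add filtered_q) (auto elim: D.filtered_mono)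
  qed
  ultimately show ?thesis by (auto simp: reduces_def)
qed

text \<open>By induction the \<open>k\<close>-th iterate \<open>W k\<close> has normal form
  \<open>(z - x) z^k xb^k \<beta>\<close>. Hence \<open>f (W k) = q z^(k+1) xb^k \<beta>\<close>;
  the prefactor \<open>z^(-k-1)\<close> cancels the power of \<open>z\<close>, and the series sums
  to \<open>q (1 - xb)^(-1) \<beta>\<close>.\<close>

lemma psi_map_eq_Sum_any:
  assumes f: "\<And>w. w \<in> D.filtered 0 \<Longrightarrow> f w = q \<circ> zpow 1 (inv_z_sub_x (Phi w))"
    and w: "w \<in> D.filtered 0"
  shows "w + Sum_any (\<lambda>k. if k \<ge> 1
          then zpow (- int k) (f (((\<lambda>u. zpow 1 u + f u) ^^ (k - 1)) w)) else 0) = psi_map w"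
proof -
  let ?\<beta> = "inv_z_sub_x (Phi w)"
  define \<gamma> where "\<gamma> k = zpow (int k) ((xb ^^ k) \<circ> ?\<beta>)" for k
  define W where "W k = ((\<lambda>u. zpow 1 u + f u) ^^ k) w" for k
  have f_W: "f w = q \<circ> zpow 1 \<gamma>" if "reduces w (z_sub_x \<gamma>)" for w \<gamma>
  proof -
    have "w \<in> D.filtered 0" using that by (simp add: reduces_def)
    moreover from this have "Phi w = z_sub_x \<gamma>"
      using that reduces_unique reduces_Phi by blast
    ultimately show ?thesis by (simp add: f inv_z_sub_x)
  qed
  have red: "reduces (W k) (z_sub_x (\<gamma> k))" for k
  proof (induction k)
    case 0
    have "\<gamma> 0 = ?\<beta>" by (auto simp: \<gamma>_def zpow_def)
    then show ?case using reduces_Phi[OF w] by (simp add: W_def z_sub_x_inv)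
  next
    case (Suc k)
    have "\<gamma> (Suc k) = zpow 1 (xb \<circ> \<gamma> k)"
      by (auto simp: \<gamma>_def zpow_def fun_eq_iff algebra_simps)
    moreover have "W (Suc k) = zpow 1 (W k) + f (W k)"
      by (simp add: W_def)
    ultimately show ?case
      using reduces_step[OF Suc] by (simp only: f_W[OF Suc])
  qed
  have term_eq: "zpow (- int (Suc k)) (f (W k)) = q \<circ> ((xb ^^ k) \<circ> ?\<beta>)" for k
    by (auto simp: f_W[OF red] \<gamma>_def zpow_def fun_eq_iff)
  let ?T = "\<lambda>k. if k \<ge> 1 then zpow (- int k) (f (((\<lambda>u. zpow 1 u + f u) ^^ (k - 1)) w)) else 0"
  have T_Suc: "?T (Suc k) = q \<circ> ((xb ^^ k) \<circ> ?\<beta>)" for k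
    using term_eq[of k] by (simp add: W_def)
  \<comment> \<open>The \<open>k\<close>-th term contains \<open>xb ^^ (k - 1)\<close>. Finite
    support is what keeps \<open>Sum_any\<close> from being its default value 0.\<close>
  have "{k. ?T k \<noteq> 0} \<subseteq> {1..<Suc n}"
  proof
    fix k assume "k \<in> {k. ?T k \<noteq> 0}"
    then obtain k' where k': "k = Suc k'" "?T (Suc k') \<noteq> 0"
      by (cases k) auto
    then have "\<not> n \<le> k'"
      unfolding T_Suc by (auto simp: pow_xb_zero op_simps fun_eq_iff)
    then show "k \<in> {1..<Suc n}" using k' by simp
  qed
  then have "Sum_any ?T = (\<Sum>k\<in>{1..<Suc n}. ?T k)"
    by (intro Sum_any.expand_superset) auto
  also have "\<dots> = (\<Sum>k<n. q \<circ> ((xb ^^ k) \<circ> ?\<beta>))"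
    unfolding T_Suc[symmetric] by (simp add: sum.atLeast1_atMost_eq atLeastLessThanSuc_atLeastAtMost)
  also have "\<dots> = q \<circ> inv_one_sub_xb ?\<beta>"
    by (auto simp: sum_fun_apply inv_one_sub_xb_def op_simps)
  finally show ?thesis by (simp add: psi_map_def)
qed

text \<open>Summing over \<open>j'\<close> for fixed \<open>h'\<close> gives the coefficient of
  \<open>Phi w\<close> at \<open>- h'\<close>; summing over \<open>h'\<close> with
  \<open>l = j - h'\<close> gives the geometric series of \<open>z (z - x)^(-1)\<close>.\<close>

lemma f1_eq_resolvent:
  "(\<Sum>j = 1..<n. \<Sum>j' = 1..<n. \<Sum>h' = 1..min j j'.
      monomial (- int j)
        (q ((x ^^ (j - h')) ((xb ^^ (j' - h')) (p (cD j' (polar_part w (- int h'))))))))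
   = q \<circ> zpow 1 (inv_z_sub_x (Phi w))" (is "?L = ?R")
proof
  fix t
  define T where "T j j' h' = q ((x ^^ (j - h')) ((xb ^^ (j' - h')) (p (cD j' (w (- int h'))))))"
    for j j' h'
  have L: "?L t = (\<Sum>j = 1..<n. if t = - int j then \<Sum>j' = 1..<n. \<Sum>h' = 1..min j j'. T j j' h' else 0)"
    by (auto simp: sum_fun_apply monomial_def polar_part_def T_def intro!: sum.cong)
  have R: "?R t = (\<Sum>l<n. q ((x ^^ l) (Phi w (t + int l))))"
    by (simp add: zpow_def inv_z_sub_x_def op_simps algebra_simps)
  consider "t \<ge> 0" | "t \<le> - int n" | j where "t = - int j" "1 \<le> j" "j < n"
    by (cases "t \<ge> 0 \<or> t \<le> - int n") (auto intro: that(3)[of "nat (- t)"])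
  then show "?L t = ?R t"
  proof cases
    case 1
    then show ?thesis unfolding L R
      by (auto simp: Phi_def pow_x_simps op_simps intro!: sum.neutral)
  next
    case 2
    \<comment> \<open>\<open>z^(-l) x^l\<close> preserves degree, so the \<open>i\<close>-th
      component could be nonzero only for \<open>i = - t\<close>, which is outside the range of
      indices.\<close>
    have "(x ^^ l) (Phi w (t + int l)) = 0" for l
    proof (rule V.eq_zeroI)
      fix i
      show "cV i ((x ^^ l) (Phi w (t + int l))) = 0"
      proof (cases "i < n")
        case True
        then show ?thesis
          using homogeneous_Phi[of w] 2 by (auto simp: c_pow_x V.homogeneous_def pow_x_simps)
      qed (simp add: V.c_outside)
    qed
    then show ?thesis unfolding L R using 2 by (auto simp: op_simps intro!: sum.neutral)
  next
    case (3 j)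
    have "?L t = (\<Sum>j' = 1..<n. \<Sum>h' = 1..min j j'. T j j' h')"
      unfolding L using 3 by (simp add: sum.delta)
    also have "\<dots> = (\<Sum>j' = 1..<n. \<Sum>h' = 1..j. if h' \<le> j' then T j j' h' else 0)"
      by (intro sum.cong refl sum.mono_neutral_cong_left) auto
    also have "\<dots> = (\<Sum>h' = 1..j. \<Sum>j' = 1..<n. if h' \<le> j' then T j j' h' else 0)"
      by (rule sum.swap)
    also have "\<dots> = (\<Sum>h' = 1..j. \<Sum>j' = h'..<n. T j j' h')"
      by (intro sum.cong refl sum.mono_neutral_cong_right) auto
    also have "\<dots> = (\<Sum>h' = 1..j. q ((x ^^ (j - h')) (Phi w (- int h'))))"
      unfolding Phi_def T_def
      by (intro sum.cong refl) (auto simp: op_simps pow_x_simps of_nat_diff nat_diff_distrib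
          intro!: sum.cong)
    also have "\<dots> = (\<Sum>l<j. q ((x ^^ l) (Phi w (t + int l))))"
      by (rule sum.reindex_bij_witness[of _ "\<lambda>l. j - l" "\<lambda>h'. j - h'"])
        (auto simp: 3 of_nat_diff)
    \<comment> \<open>For \<open>l \<ge> j\<close> the argument \<open>t + int l\<close> is
      nonnegative, where \<open>Phi w\<close> is 0 by definition.\<close>
    also have "\<dots> = ?R t"
      unfolding R using 3
      by (intro sum.mono_neutral_left) (auto simp: Phi_def op_simps pow_x_simps)
    finally show ?thesis .
  qed
qed

lemma composite_map_eq_Sum_any:
  "w + zpow (- 1) (Sum_any (\<lambda>(r, l). zpow (- int l) (\<lambda>t. q ((xb ^^ r) ((x ^^ l) (p (w t))))))) = composite_map w"
proof -
  let ?T = "\<lambda>(r, l). zpow (- int l) (\<lambda>t. q ((xb ^^ r) ((x ^^ l) (p (w t)))))"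
  have "{rl. ?T rl \<noteq> 0} \<subseteq> {..<n} \<times> {..<n}"
  proof (rule subsetI, rule ccontr)
    fix rl assume a: "rl \<in> {rl. ?T rl \<noteq> 0}" "rl \<notin> {..<n} \<times> {..<n}"
    obtain r l where rl: "rl = (r, l)" by (cases rl)
    then have "(xb ^^ r) ((x ^^ l) u) = 0" for u
      using a(2) by (cases "r < n") (auto simp: pow_x_zero pow_xb_zero pow_xb_simps)
    then have "?T rl = 0" by (simp add: rl op_simps zpow_def fun_eq_iff)
    then show False using a(1) by simp
  qed
  then have "Sum_any ?T = (\<Sum>rl\<in>{..<n} \<times> {..<n}. ?T rl)"
    by (intro Sum_any.expand_superset) auto
  also have "\<dots> = (\<Sum>r<n. \<Sum>l<n. ?T (r, l))"
    by (simp add: sum.cartesian_product)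
  finally have S: "Sum_any ?T = (\<Sum>r<n. \<Sum>l<n. ?T (r, l))" .
  show ?thesis
    unfolding S composite_map_def
    by (auto simp: fun_eq_iff zpow_def sum_fun_apply inv_one_sub_xb_def inv_z_sub_x_def op_simps
        pow_xb_simps)
qed

end

section \<open>From direct sum decompositions to gradings by projections\<close>

lemma decomposes_component:
  assumes "\<exists>!c. decomposes n U u c"
  shows "decomposes n U u (\<lambda>i. component n U i u)"
  using theI'[OF assms] by (simp add: component_def)

lemma component_eqI:
  assumes "\<exists>!c. decomposes n U u c" "decomposes n U u c"
  shows "component n U i u = c i"
  using assms by (metis component_def the1_equality)

lemma
  fixes U :: "nat \<Rightarrow> 'a::ab_group_add set"
  assumes direct: "\<And>u. \<exists>!c. decomposes n U u c"
    and zero: "\<And>i. 0 \<in> U i"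
    and add: "\<And>i u w. u \<in> U i \<Longrightarrow> w \<in> U i \<Longrightarrow> u + w \<in> U i"
    and outside: "\<And>i. i \<notin> {1..<n} \<Longrightarrow> U i = {0}"
  shows component_of_mem: "u \<in> U j \<Longrightarrow> component n U i u = (if i = j then u else 0)"
    and grading_component: "grading n (component n U)"
proof -
  have dec: "component n U i u \<in> U i" "i \<notin> {1..<n} \<Longrightarrow> component n U i u = 0"
    "u = (\<Sum>i = 1..<n. component n U i u)" for i u
    using decomposes_component[OF direct, of u] by (auto simp: decomposes_def)
  show *: "component n U i u = (if i = j then u else 0)" if "u \<in> U j" for i j u
  proof (rule component_eqI[OF direct])
    show "decomposes n U u (\<lambda>i. if i = j then u else 0)"
      using that zero outside[of j] by (auto simp: decomposes_def sum.delta)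
  qed
  show "grading n (component n U)"
  proof
    show "component n U i (u + w) = component n U i u + component n U i w" for i u w
    proof (rule component_eqI[OF direct])
      show "decomposes n U (u + w) (\<lambda>i. component n U i u + component n U i w)"
        using dec(1,2) dec(3)[of u] dec(3)[of w] add
        by (simp add: decomposes_def sum.distrib)
    qed
  qed (use dec *[OF dec(1)] in auto)
qed

section \<open>Quiver data as a graded representation; the formulas and the quotient\<close>

context quiver
begin

lemma subspace_V: "vs.subspace (V i)"
  using V_dim[of i] vs.subspace_span by metis

lemma subspace_D: "ds.subspace (D i)"
  using D_dim[of i] ds.subspace_span by metis

lemma V_outside: "i \<notin> {1..<n} \<Longrightarrow> V i = {0}"
  using V_dim[of i] v_outside[of i] by (metis card_0_eq vs.span_empty)

lemma D_outside: "i \<notin> {1..<n} \<Longrightarrow> D i = {0}"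
  using D_dim[of i] d_outside[of i] by (metis card_0_eq ds.span_empty)

lemma V_comp: "u \<in> V j \<Longrightarrow> component n V i u = (if i = j then u else 0)"
  by (rule component_of_mem)
    (rule V_direct vs.subspace_0[OF subspace_V] V_outside vs.subspace_add[OF subspace_V] | assumption)+

lemma D_comp: "a \<in> D j \<Longrightarrow> component n D i a = (if i = j then a else 0)"
  by (rule component_of_mem)
    (rule D_direct ds.subspace_0[OF subspace_D] D_outside ds.subspace_add[OF subspace_D] | assumption)+

lemma component_V_mem: "component n V i u \<in> V i" and component_D_mem: "component n D i a \<in> D i"
  using decomposes_component[OF V_direct] decomposes_component[OF D_direct]
  by (auto simp: decomposes_def)

sublocale gV: grading n "component n V"
  by (rule grading_component)
    (rule V_direct vs.subspace_0[OF subspace_V] V_outside vs.subspace_add[OF subspace_V] | assumption)+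

sublocale gD: grading n "component n D"
  by (rule grading_component)
    (rule D_direct ds.subspace_0[OF subspace_D] D_outside ds.subspace_add[OF subspace_D] | assumption)+

lemma quiver_rep_M0:
  assumes "(x, xb, p, q) \<in> M0"
  shows "quiver_rep n (component n V) (component n D) x xb p q"
proof -
  have lin: "Vector_Spaces.linear scV scV x" "Vector_Spaces.linear scV scV xb"
      "Vector_Spaces.linear scD scV p" "Vector_Spaces.linear scV scD q"
    and x: "\<And>i u. u \<in> V i \<Longrightarrow> x u \<in> V (Suc i)"
    and xb: "\<And>i u. u \<in> V (Suc i) \<Longrightarrow> xb u \<in> V i"
    and p: "\<And>i a. a \<in> D i \<Longrightarrow> p a \<in> V i"
    and q: "\<And>i u. u \<in> V i \<Longrightarrow> q u \<in> D i"
    and rel: "\<And>i u. i \<in> {1..<n} \<Longrightarrow> u \<in> V i \<Longrightarrow> xb (x u) = x (xb u) + p (q u)"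
    using assms by (auto simp: M0_def image_subset_iff)
  have addv: "additive x" "additive xb" "additive p" "additive q"
    using lin by (auto simp: additive_def Vector_Spaces.linear_iff)
  note sums = addv[THEN additive.sum] and zeros = addv[THEN additive.zero]
  \<comment> \<open>At \<open>j = 0\<close> the truncated index is harmless since the component is
    zero.\<close>
  have xb': "xb (component n V j u) \<in> V (j - 1)" for j u
    using component_V_mem[of j u] xb[of _ "j - 1"] vs.subspace_0[OF subspace_V]
    by (cases j) (auto simp: gV.c_outside zeros)
  show ?thesis
  proof
    show "component n V (Suc i) (x u) = x (component n V i u)" for i u
    proof -
      have "component n V (Suc i) (x u) = (\<Sum>j = 1..<n. component n V (Suc i) (x (component n V j u)))"
        by (metis gV.sum_c gV.c_simps(4) sums(1))
      also have "\<dots> = (\<Sum>j = 1..<n. if i = j then x (component n V j u) else 0)"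
        by (intro sum.cong refl) (simp add: V_comp[OF x[OF component_V_mem]])
      also have "\<dots> = x (component n V i u)"
        using gV.c_outside[of i u] by (auto simp: sum.delta zeros)
      finally show ?thesis .
    qed
    show "component n V i (xb u) = xb (component n V (Suc i) u)" for i u
    proof (cases "i = 0")
      case True
      have "xb (component n V (Suc 0) u) = 0"
        using xb[OF component_V_mem, of 0] V_outside[of 0] by auto
      then show ?thesis using True by (simp add: gV.c_outside)
    next
      case False
      have "component n V i (xb u) = (\<Sum>j = 1..<n. component n V i (xb (component n V j u)))"
        by (metis gV.sum_c gV.c_simps(4) sums(2))
      also have "\<dots> = (\<Sum>j = 1..<n. if Suc i = j then xb (component n V j u) else 0)"
        using False by (intro sum.cong refl) (auto simp add: V_comp[OF xb'])
      also have "\<dots> = xb (component n V (Suc i) u)"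
        using gV.c_outside[of "Suc i" u] by (auto simp: sum.delta zeros)
      finally show ?thesis .
    qed
    show "component n V i (p a) = p (component n D i a)" for i a
    proof -
      have "component n V i (p a) = (\<Sum>j = 1..<n. component n V i (p (component n D j a)))"
        by (metis gD.sum_c gV.c_simps(4) sums(3))
      also have "\<dots> = (\<Sum>j = 1..<n. if i = j then p (component n D j a) else 0)"
        by (intro sum.cong refl) (simp add: V_comp[OF p[OF component_D_mem]])
      also have "\<dots> = p (component n D i a)"
        using gD.c_outside[of i a] by (auto simp: sum.delta zeros)
      finally show ?thesis .
    qed
    show "component n D i (q u) = q (component n V i u)" for i u
    proof -
      have "component n D i (q u) = (\<Sum>j = 1..<n. component n D i (q (component n V j u)))"
        by (metis gV.sum_c gD.c_simps(4) sums(4))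
      also have "\<dots> = (\<Sum>j = 1..<n. if i = j then q (component n V j u) else 0)"
        by (intro sum.cong refl) (simp add: D_comp[OF q[OF component_V_mem]])
      also have "\<dots> = q (component n V i u)"
        using gV.c_outside[of i u] by (auto simp: sum.delta zeros)
      finally show ?thesis .
    qed
    show "xb (x u) = x (xb u) + p (q u)" for u
    proof -
      have "xb (x u) = (\<Sum>j = 1..<n. xb (x (component n V j u)))"
        by (metis gV.sum_c sums(1) sums(2))
      also have "\<dots> = (\<Sum>j = 1..<n. x (xb (component n V j u)) + p (q (component n V j u)))"
        by (intro sum.cong refl rel[OF _ component_V_mem])
      also have "\<dots> = x (xb u) + p (q u)"
        using gV.sum_c by (simp add: sum.distrib flip: sums)
      finally show ?thesis .
    qed
  qed (use addv in \<open>auto simp: additive_def\<close>)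
qed

lemma component_D_scale: "component n D i (scD s a) = scD s (component n D i a)"
proof (rule component_eqI[OF D_direct])
  show "decomposes n D (scD s a) (\<lambda>i. scD s (component n D i a))"
    using component_D_mem ds.subspace_scale[OF subspace_D] gD.c_outside gD.sum_c
    by (auto simp: decomposes_def simp flip: ds.scale_sum_right)
qed

text \<open>Translates the spans by which lattices are defined into vanishing of projections, the
  language of \<open>filtered\<close>.\<close>

lemma span_Union_D:
  assumes "I \<subseteq> {1..<n}"
  shows "ds.span (\<Union>i\<in>I. D i) = {a. \<forall>i. i \<notin> I \<longrightarrow> component n D i a = 0}"
proof
  have "ds.subspace {a. \<forall>i. i \<notin> I \<longrightarrow> component n D i a = 0}"
    by (auto simp: ds.subspace_def gD.c_simps component_D_scale)
  then show "ds.span (\<Union>i\<in>I. D i) \<subseteq> {a. \<forall>i. i \<notin> I \<longrightarrow> component n D i a = 0}"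
    by (rule ds.span_minimal[rotated]) (use D_comp in force)
next
  show "{a. \<forall>i. i \<notin> I \<longrightarrow> component n D i a = 0} \<subseteq> ds.span (\<Union>i\<in>I. D i)"
  proof
    fix a assume a: "a \<in> {a. \<forall>i. i \<notin> I \<longrightarrow> component n D i a = 0}"
    have "component n D i a \<in> ds.span (\<Union>i\<in>I. D i)" for i
    proof (cases "i \<in> I")
      case True
      then show ?thesis using component_D_mem by (intro ds.span_base) blast
    next
      case False
      then show ?thesis using a by (simp add: ds.span_zero)
    qed
    then show "a \<in> ds.span (\<Union>i\<in>I. D i)"
      by (subst gD.sum_c[symmetric]) (rule ds.span_sum)
  qed
qed

lemma L_lambda_eq: "L_lambda = gD.filtered 0"
proof -
  have "a \<in> ds.span (\<Union>i\<in>{i. 1 \<le> i \<and> i < n \<and> - int i \<le> t}. D i) \<longleftrightarrow>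
      (\<forall>i. int i + t < 0 \<longrightarrow> component n D i a = 0)" for a t
    using gD.c_outside by (subst span_Union_D) force+
  then show ?thesis by (simp add: L_lambda_def gD.filtered_def)
qed

text \<open>\<open>phi_formula\<close> is restricted to \<open>Dt\<close>, so its value at a polar
  part is the intended one only with this membership.\<close>

lemma polar_part_mem_Dt: "w \<in> L_lambda \<Longrightarrow> polar_part w \<in> Dt"
proof -
  assume w: "w \<in> L_lambda"
  have "polar_part w t \<in> ds.span (\<Union>j\<in>{j. j < n \<and> 1 \<le> - t \<and> - t \<le> int j}. D j)" for t
  proof (cases "t < 0")
    case True
    then have "{i. 1 \<le> i \<and> i < n \<and> - int i \<le> t} = {j. j < n \<and> 1 \<le> - t \<and> - t \<le> int j}"
      by auto
    then show ?thesis using w True unfolding L_lambda_def polar_part_def by (metis (mono_tags, lifting) mem_Collect_eq)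
  qed (simp add: polar_part_def ds.span_zero)
  then show ?thesis by (simp add: Dt_def)
qed

lemma psi_phi_eq_composite:
  assumes Q: "Q \<in> M0"
  shows "psi_formula (phi_formula Q) = composite_formula Q"
proof -
  obtain x xb p q where Q_eq: "Q = (x, xb, p, q)" by (cases Q)
  interpret quiver_rep n "component n V" "component n D" x xb p q
    using Q by (intro quiver_rep_M0) (simp add: Q_eq)
  \<comment> \<open>Subtracting the shift recovers \<open>f1\<close>, viewed as a map on
    \<open>L_lambda\<close> through its quotient by series without polar part.\<close>
  define f where "f w = phi_formula Q (polar_part w) - shift (polar_part w)" for w
  have f: "f w = q \<circ> zpow 1 (inv_z_sub_x (Phi w))" if "w \<in> gD.filtered 0" for w
    using polar_part_mem_Dt that f1_eq_resolvent[of w]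
    by (simp add: f_def phi_formula_def L_lambda_eq Q_eq f1_def)
  have "psi_formula (phi_formula Q) = psi_map ` gD.filtered 0"
    unfolding psi_formula_def Let_def L_lambda_eq f_def[symmetric]
    by (intro image_cong refl psi_map_eq_Sum_any f)
  also have "\<dots> = composite_formula Q"
    by (simp add: psi_image_eq_composite_image composite_formula_def Q_eq L_lambda_eq composite_map_eq_Sum_any)
  finally show ?thesis .
qed

text \<open>Invariants are restricted to \<open>M0\<close>; their values along an orbit are those of
  the underlying polynomial only because the orbit stays in \<open>M0\<close>.\<close>

lemma GV_act_M0:
  assumes g: "g \<in> GV" and Q: "Q \<in> M0"
  shows "GV_act g Q \<in> M0"
proof -
  obtain x xb p q where Q_eq: "Q = (x, xb, p, q)" by (cases Q)
  have g': "Vector_Spaces.linear scV scV g" "bij g" "\<And>i. g ` V i = V i"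
    using g by (auto simp: GV_def)
  have inv: "Vector_Spaces.linear scV scV (inv g)"
    using bij_module_hom_imp_inv_module_hom[of scV scV g] g'(1,2) vs.vector_space_axioms
    by (simp add: Vector_Spaces.linear_def)
  have inv_V: "inv g ` V i = V i" for i
    by (metis g'(2,3) bij_is_inj image_inv_f_f)
  have gV: "g u \<in> V i" "inv g u \<in> V i" if "u \<in> V i" for u i
    using g'(3) inv_V that by blast+
  have gi: "inv g (g u) = u" for u
    using g'(2) by (simp add: bij_is_inj)
  have gadd: "g (u + w) = g u + g w" for u w
    using g'(1) by (simp add: Vector_Spaces.linear_iff)
  have lin: "Vector_Spaces.linear scV scV x" "Vector_Spaces.linear scV scV xb"
      "Vector_Spaces.linear scD scV p" "Vector_Spaces.linear scV scD q"
    using Q by (auto simp: M0_def Q_eq)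
  show ?thesis
    using Q unfolding Q_eq M0_def GV_act_def
    by (auto simp: image_subset_iff gV gi gadd simp del: o_apply
        intro!: Vector_Spaces.linear_compose g'(1) inv lin) (auto simp: gV gi gadd)
qed

text \<open>Evaluation at \<open>Q\<close> is an algebra homomorphism. The work lies in showing that
  constants, sums and products of invariants are again invariants, since \<open>quot_map\<close>
  takes its default value elsewhere.\<close>

lemma quot_map_mem_spec_points:
  assumes Q: "Q \<in> M0"
  shows "quot_map Q \<in> spec_points"
proof -
  have invariantI: "restrict f M0 \<in> invariants"
    if "f \<in> polyfun quad_coords" "\<And>g Q. g \<in> GV \<Longrightarrow> Q \<in> M0 \<Longrightarrow> f (GV_act g Q) = f Q" for f
    using that GV_act_M0 unfolding invariants_def by simp
  have invariantD: "\<exists>f0 \<in> polyfun quad_coords. f = restrict f0 M0 \<and>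
      (\<forall>g\<in>GV. \<forall>Q\<in>M0. f0 (GV_act g Q) = f0 Q)" if f: "f \<in> invariants" for f
  proof -
    obtain f0 where f0: "f0 \<in> polyfun quad_coords" "f = restrict f0 M0"
      using f by (auto simp: invariants_def)
    then have "f0 (GV_act g Q) = f0 Q" if "g \<in> GV" "Q \<in> M0" for g Q
    proof -
      have "f (GV_act g Q) = f Q" using f that unfolding invariants_def by blast
      then show ?thesis using f0(2) GV_act_M0[OF that] that by simp
    qed
    then show ?thesis using f0 by blast
  qed
  have const: "restrict (\<lambda>_. c) M0 \<in> invariants" for c
    by (intro invariantI polyfun.const refl)
  have sums: "restrict (\<lambda>Q. f Q + h Q) M0 \<in> invariants"
    and prods: "restrict (\<lambda>Q. f Q * h Q) M0 \<in> invariants"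
    if f: "f \<in> invariants" and h: "h \<in> invariants" for f h
  proof -
    obtain f0 h0 where fh: "f = restrict f0 M0" "h = restrict h0 M0"
      "f0 \<in> polyfun quad_coords" "h0 \<in> polyfun quad_coords"
      "\<And>g Q. g \<in> GV \<Longrightarrow> Q \<in> M0 \<Longrightarrow> f0 (GV_act g Q) = f0 Q"
      "\<And>g Q. g \<in> GV \<Longrightarrow> Q \<in> M0 \<Longrightarrow> h0 (GV_act g Q) = h0 Q"
      using invariantD[OF f] invariantD[OF h] by blast
    have "restrict (\<lambda>Q. f Q + h Q) M0 = restrict (\<lambda>Q. f0 Q + h0 Q) M0"
      "restrict (\<lambda>Q. f Q * h Q) M0 = restrict (\<lambda>Q. f0 Q * h0 Q) M0"
      by (auto simp: fh(1,2))
    moreover have "restrict (\<lambda>Q. f0 Q + h0 Q) M0 \<in> invariants"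
      "restrict (\<lambda>Q. f0 Q * h0 Q) M0 \<in> invariants"
      using fh(3-) by (auto intro!: invariantI polyfun.add polyfun.mult)
    ultimately show "restrict (\<lambda>Q. f Q + h Q) M0 \<in> invariants"
      "restrict (\<lambda>Q. f Q * h Q) M0 \<in> invariants"
      by simp_all
  qed
  show ?thesis
    using Q const sums prods by (auto simp: spec_points_def quot_map_def)
qed

end

lemma points_affine_variety: "points (affine_variety C Y) = Y"
  by (simp add: points_def affine_variety_def)

theorem theorem10p1p1:
  fixes scV :: "complex \<Rightarrow> 'v::ab_group_add \<Rightarrow> 'v"
    and scD :: "complex \<Rightarrow> 'd::ab_group_add \<Rightarrow> 'd"
    and n :: nat
    and v d :: "nat \<Rightarrow> nat"
    and V :: "nat \<Rightarrow> 'v set"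
    and D :: "nat \<Rightarrow> 'd set"
    and e :: "nat \<Rightarrow> 'd"
    and \<phi> :: "((('v, 'd) quad \<Rightarrow> complex) \<Rightarrow> complex) \<Rightarrow> 'd series \<Rightarrow> 'd series"
    and \<psi> :: "('d series \<Rightarrow> 'd series) \<Rightarrow> 'd series set"
  assumes "n \<ge> 2"
    and "quiver scV scD n v d V D e"
    and "quiver.Mreg scV scD n V D \<noteq> {}"
    and "variety_iso (quiver.M00 scV scD n V D) (quiver.T_slice scD n v d D) \<phi>"
    and "\<forall>Q \<in> quiver.M0 scV scD n V D.
           \<phi> (quiver.quot_map scV scD n V D Q) = quiver.phi_formula scD n D Q"
    and "variety_iso (quiver.T_slice scD n v d D) (quiver.Gr_slice scD n v d D e) \<psi>"
    and "\<forall>A \<in> points (quiver.T_slice scD n v d D). \<psi> A = quiver.psi_formula scD n D A"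
  shows "variety_iso (quiver.M00 scV scD n V D) (quiver.Gr_slice scD n v d D e) (\<psi> \<circ> \<phi>) \<and>
    (\<forall>Q \<in> quiver.M0 scV scD n V D.
       (\<psi> \<circ> \<phi>) (quiver.quot_map scV scD n V D Q) = quiver.composite_formula scD n D Q)"
proof (intro conjI ballI)
  interpret quiver scV scD n v d V D e by fact
  show "variety_iso M00 Gr_slice (\<psi> \<circ> \<phi>)"
    by (rule variety_iso_comp) fact+
  fix Q assume Q: "Q \<in> M0"
  \<comment> \<open>The formula for \<open>\<psi>\<close> is given on points of the slice;
    bijectivity of \<open>\<phi>\<close> places the image there.\<close>
  have "\<phi> (quot_map Q) \<in> points T_slice"
    using assms(4) quot_map_mem_spec_points[OF Q]
    by (auto simp: variety_iso_def bij_betw_def M00_def points_affine_variety)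
  then show "(\<psi> \<circ> \<phi>) (quot_map Q) = composite_formula Q"
    using assms(5,7) Q psi_phi_eq_composite[OF Q] by simp
qed

end
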